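(* Let $r\ge 3$. For each $\varepsilon>0$ there exists $r_0$ such that for every $r>r_0$, every finite set $X\subset\{2,3,4,\dots\}$ with $|X|\le r$ that is eventually EKR (for this $r$), and every integer $n>(2+\varepsilon)r^2$ with $X\subseteq[2,n]$, the set $X$ is EKR (for $n$ and $r$). Furthermore, for $r\ge 3$, a finite set $X\subset\{2,3,\dots\}$ with $|X|\le r$ that is eventually EKR for $r$, and $n$ with $X\subseteq[2,n]$: (1) if $|X|=1$ and $r\ge 12$, then $n>2r^2$ implies $X$ is EKR; (2) if $|X|=2$ and $r\ge 14$, then $n>2r^2$ implies $X$ is EKR; (3) if $|X|=3$ and $r\ge 14$, then $n>3r^2$ implies $X$ is EKR; (4) if $|X|=t\ge 4$ and $r\ge\max\{11,t\}$, then $n>tr^2$ implies $X$ is EKR.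
   Context: For integers $a\le b$, $[a,b]=\{a,\dots,b\}$ and $[n]=[1,n]$. $\binom{[n]}{r}$ is the set of $r$-element subsets of $[n]$; elements $A=\{a_1,\dots,a_r\}$ are always listed increasingly, $a_1<\dots<a_r$. A family is a subset $\mathcal{A}\subseteq\binom{[n]}{r}$; it is intersecting if any two members (not necessarily distinct) intersect. Compression order: for $A,B\in\binom{[n]}{r}$, $A\le B$ iff $a_i\le b_i$ for all $i$. A family $\mathcal{A}$ is compressed if $A\in\mathcal{A}$ and $B\le A$ imply $B\in\mathcal{A}$. For a set $X$, $\mathcal{A}(X)=\{A\in\mathcal{A}:A\cap X\neq\emptyset\}$, and $\mathcal{S}_{n,r}=\{A\in\binom{[n]}{r}:1\in A\}$. A set $X\subseteq[2,n]$ is EKR (for $n,r$) if $|\mathcal{A}(X)|\le|\mathcal{S}_{n,r}(X)|$ for every compressed intersecting family $\mathcal{A}\subseteq\binom{[n]}{r}$. For fixed $r$, a finite set $X\subset\{2,3,\dots\}$ is eventually EKR if $X$ is EKR for $n,r$ for all sufficiently large $n$. *)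

theory Defs
  imports Complex_Main "HOL-Library.Ramsey"
begin

(* nsets {1..n} r is the family of all r-element subsets of [n]. *)

definition intersecting :: "nat set set \<Rightarrow> bool" where
  "intersecting F \<longleftrightarrow> (\<forall>A\<in>F. \<forall>B\<in>F. A \<inter> B \<noteq> {})"

(* For finite sets of different cardinalities this is False; it is only used within nsets {1..n} r. *)
definition compression_le :: "nat set \<Rightarrow> nat set \<Rightarrow> bool" where
  "compression_le A B \<longleftrightarrow> list_all2 (\<le>) (sorted_list_of_set A) (sorted_list_of_set B)"

definition compressed :: "nat \<Rightarrow> nat \<Rightarrow> nat set set \<Rightarrow> bool" where
  "compressed n r F \<longleftrightarrow>
     (\<forall>A\<in>F. \<forall>B\<in>nsets {1..n} r. compression_le B A \<longrightarrow> B \<in> F)"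

definition hitting :: "nat set set \<Rightarrow> nat set \<Rightarrow> nat set set" where
  "hitting F X = {A \<in> F. A \<inter> X \<noteq> {}}"

definition star :: "nat \<Rightarrow> nat \<Rightarrow> nat set set" where
  "star n r = {A \<in> nsets {1..n} r. 1 \<in> A}"

definition EKR :: "nat \<Rightarrow> nat \<Rightarrow> nat set \<Rightarrow> bool" where
  "EKR n r X \<longleftrightarrow> X \<subseteq> {2..n} \<and>
     (\<forall>F \<subseteq> nsets {1..n} r. compressed n r F \<and> intersecting F \<longrightarrow>
        card (hitting F X) \<le> card (hitting (star n r) X))"

definition eventually_EKR :: "nat \<Rightarrow> nat set \<Rightarrow> bool" where
  "eventually_EKR r X \<longleftrightarrow> finite X \<and> X \<subseteq> {2..} \<and> (\<forall>\<^sub>F n in sequentially. EKR n r X)"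

end

theory Submission
  imports Defs
begin

text \<open>
  Let \<open>F\<close> be compressed and intersecting. Comparison with the odd and the even numbers shows that each
  \<open>A \<in> F\<close> has at least \<open>k\<close> elements in \<open>[2k - 1]\<close> for some \<open>k\<close>. Among the members avoiding \<open>1\<close>, those
  with \<open>k \<ge> 3\<close> number at most \<open>5 (r/n) b\<close>, where \<open>b = (n - 3) choose (r - 2)\<close>, and those with \<open>k = 2\<close>
  contain \<open>{2, 3}\<close>, so there are at most \<open>b\<close> of them. If \<open>X\<close> is eventually EKR, the Hilton--Milner family
  forces some \<open>x \<in> X\<close> with \<open>x \<ge> r + 2\<close>, and the triangle family \<open>{A. card (A \<inter> [3]) \<ge> 2}\<close> forces \<open>X\<close> to
  miss \<open>{2, 3}\<close> or to have two elements outside it.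

  If every member of \<open>F\<close> in the star meets \<open>{2, 3}\<close>, two such elements give about \<open>2 b\<close> sets of the star
  that \<open>F\<close> loses. If not, compression gives \<open>{1, 4, \<dots>, r + 2} \<in> F\<close>, so the members containing \<open>{2, 3}\<close> but not
  \<open>1\<close> meet \<open>[4, r + 2]\<close> and number at most \<open>(r - 1)(r/n) b\<close>, while at least \<open>(1 - (r - 1)(r/n)) b\<close> sets are
  lost because \<open>[2, r + 1] \<in> F\<close>. This last comparison needs \<open>n\<close> slightly above \<open>2 r\<^sup>2\<close>. When \<open>X\<close> misses \<open>{2, 3}\<close>
  and has at most two elements, \<open>X\<close> itself plays the role of \<open>[4, r + 2]\<close>.
\<close>

section \<open>The compression order\<close>

lemma nsets_fin:
  assumes "A \<in> nsets {1..n::nat} r"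
  shows "finite A" "card A = r" "A \<subseteq> {1..n}"
  using assms by (auto simp: nsets_def)

text \<open>The entries at positions 0 to \<open>i\<close> are \<open>i + 1\<close> distinct
  elements of \<open>A\<close> bounded by entry \<open>i\<close>. This turns upper bounds on counts
  in initial segments into lower bounds on sorted entries.\<close>

lemma nth_card_le:
  assumes "finite (A :: nat set)" "i < card A"
  shows "Suc i \<le> card (A \<inter> {..sorted_list_of_set A ! i})"
proof -
  let ?xs = "sorted_list_of_set A"
  have len: "length ?xs = card A" by simp
  have "inj_on (\<lambda>j. ?xs ! j) {..i}"
    using assms len by (auto simp: inj_on_def nth_eq_iff_index_eq)
  hence "card ((\<lambda>j. ?xs ! j) ` {..i}) = Suc i" by (simp add: card_image)
  moreover have "(\<lambda>j. ?xs ! j) ` {..i} \<subseteq> A \<inter> {..?xs ! i}"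
  proof
    fix y assume "y \<in> (\<lambda>j. ?xs ! j) ` {..i}"
    then obtain j where j: "j \<le> i" "y = ?xs ! j" by auto
    have "?xs ! j \<in> set ?xs" using j assms len by (intro nth_mem) auto
    moreover have "?xs ! j \<le> ?xs ! i" using j assms len by (intro sorted_nth_mono) auto
    ultimately show "y \<in> A \<inter> {..?xs ! i}" using j assms by simp
  qed
  ultimately show ?thesis using card_mono[of "A \<inter> {..?xs ! i}"] assms by (metis finite_Int)
qed

text \<open>An entrywise smaller list has at least as many entries up to \<open>m\<close>. Families
  defined by lower bounds on such counts are therefore compressed.\<close>

lemma compression_le_card:
  assumes "compression_le B A" "finite A" "finite B"
  shows "card (A \<inter> {..m}) \<le> card (B \<inter> {..m})"
proof -
  have *: "card (C \<inter> {..m}) = length (filter (\<lambda>x. x \<le> m) (sorted_list_of_set C))"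
    if "finite C" for C :: "nat set"
  proof -
    have "C \<inter> {..m} = set (filter (\<lambda>x. x \<le> m) (sorted_list_of_set C))" using that by auto
    thus ?thesis by (metis distinct_card distinct_filter distinct_sorted_list_of_set)
  qed
  have "length (filter (\<lambda>x. x \<le> m) ys) \<le> length (filter (\<lambda>x. x \<le> m) xs)"
    if "list_all2 (\<le>) xs ys" for xs ys :: "nat list"
    using that by (induction rule: list_all2_induct) auto
  with assms * show ?thesis by (simp add: compression_le_def)
qed

text \<open>An increasing \<open>f\<close> lists its own image in order, so the compression order
  reduces to entrywise bounds; the upper bound \<open>n\<close> is inherited from
  \<open>A\<close>.\<close>

lemma compressed_imageI:
  assumes F: "compressed n r F" "F \<subseteq> nsets {1..n} r" "A \<in> F"
    and f: "strict_mono f" "\<And>i. i < r \<Longrightarrow> 1 \<le> f i \<and> f i \<le> sorted_list_of_set A ! i"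
  shows "f ` {..<r} \<in> F"
proof -
  have A: "finite A" "card A = r" "A \<subseteq> {1..n}" using F nsets_fin[of A n r] by auto
  have sl: "sorted_list_of_set (f ` {..<r}) = map f [0..<r]"
  proof (rule sorted_distinct_set_unique)
    show "sorted (map f [0..<r])"
      using f(1) by (simp add: sorted_iff_nth_mono strict_mono_less_eq)
    show "distinct (map f [0..<r])"
      using f(1) by (simp add: distinct_map strict_mono_on_imp_inj_on inj_on_subset[OF _ subset_UNIV])
    show "set (sorted_list_of_set (f ` {..<r})) = set (map f [0..<r])" by auto
  qed auto
  have "compression_le (f ` {..<r}) A"
    unfolding compression_le_def sl using f A by (auto simp: list_all2_conv_all_nth)
  moreover have "f ` {..<r} \<in> nsets {1..n} r"
  proof -
    have "f i \<le> n" if "i < r" for i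
    proof -
      have "sorted_list_of_set A ! i \<in> set (sorted_list_of_set A)"
        using that A by (intro nth_mem) auto
      hence "sorted_list_of_set A ! i \<le> n" using A by auto
      with f(2)[OF that] show ?thesis by linarith
    qed
    moreover have "card (f ` {..<r}) = r"
      using f(1) by (simp add: card_image inj_on_subset[OF strict_mono_imp_inj_on subset_UNIV])
    ultimately show ?thesis using f(2) by (auto simp: nsets_def)
  qed
  ultimately show ?thesis using F unfolding compressed_def by blast
qed

text \<open>Otherwise both \<open>{1, 3, \<dots>, 2r - 1}\<close> and \<open>{2, 4, \<dots>, 2r}\<close> lie below \<open>A\<close>.\<close>
lemma compressed_intersecting_dense:
  assumes F: "compressed n r F" "F \<subseteq> nsets {1..n} r" "intersecting F" "A \<in> F"
  shows "\<exists>k\<in>{1..r}. k \<le> card (A \<inter> {1..2*k-1})"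
proof (rule ccontr)
  assume neg: "\<not> ?thesis"
  have A: "finite A" "card A = r" "A \<subseteq> {1..n}" using F nsets_fin[of A n r] by auto
  \<comment> \<open>Otherwise the first \<open>i + 1\<close> elements of \<open>A\<close> lie in
    [1, 2(i + 1) - 1], and \<open>k = i + 1\<close> contradicts \<open>neg\<close>.\<close>
  have ge: "2*i+2 \<le> sorted_list_of_set A ! i" if "i < r" for i
  proof (rule ccontr)
    assume "\<not> 2*i+2 \<le> sorted_list_of_set A ! i"
    hence "A \<inter> {..sorted_list_of_set A ! i} \<subseteq> A \<inter> {1..2*(Suc i)-1}" using A by auto
    hence "card (A \<inter> {..sorted_list_of_set A ! i}) \<le> card (A \<inter> {1..2*(Suc i)-1})"
      by (intro card_mono) auto
    moreover have "Suc i \<le> card (A \<inter> {..sorted_list_of_set A ! i})"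
      using nth_card_le[of A i] A that by simp
    ultimately have "Suc i \<le> card (A \<inter> {1..2*(Suc i)-1})" by linarith
    moreover have "Suc i \<in> {1..r}" using that by simp
    ultimately show False using neg by blast
  qed
  have "(\<lambda>i. 2*i+2) ` {..<r} \<in> F" "(\<lambda>i. 2*i+1) ` {..<r} \<in> F"
    using ge by (intro compressed_imageI[OF F(1,2,4)]; force simp: strict_mono_def)+
  moreover have "(\<lambda>i. 2*i+2) ` {..<r} \<inter> (\<lambda>i. 2*i+1) ` {..<r} = {}"
    by auto presburger
  ultimately show False using F(3) unfolding intersecting_def by blast
qed

text \<open>\<open>{2..r+1}\<close> is the least r-set of positive integers avoiding 1, so it lies
  below \<open>A\<close>.\<close>

lemma compressed_without_1:
  assumes F: "compressed n r F" "F \<subseteq> nsets {1..n} r" "A \<in> F" and "1 \<notin> A"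
  shows "{2..r+1} \<in> F"
proof -
  have A: "finite A" "card A = r" "A \<subseteq> {1..n}" using F nsets_fin[of A n r] by auto
  have "i + 2 \<le> sorted_list_of_set A ! i" if "i < r" for i
  proof -
    let ?y = "sorted_list_of_set A ! i"
    have "2 \<le> a" if "a \<in> A" for a
    proof -
      have "a \<noteq> 0" "a \<noteq> 1" using that A assms by auto
      thus ?thesis by linarith
    qed
    hence "A \<inter> {..?y} \<subseteq> {2..?y}" by auto
    hence "card (A \<inter> {..?y}) \<le> card {2..?y}" by (intro card_mono) auto
    with nth_card_le[of A i] A that show ?thesis by simp
  qed
  hence "(\<lambda>i. i + 2) ` {..<r} \<in> F"
    by (intro compressed_imageI[OF F]) (auto simp: strict_mono_def)
  moreover have "(\<lambda>i. i + 2) ` {..<r} = {2..r+1}"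
  proof (intro equalityI subsetI)
    fix y assume "y \<in> {2..r+1}"
    thus "y \<in> (\<lambda>i. i + 2) ` {..<r}" by (intro image_eqI[of _ _ "y - 2"]) auto
  qed auto
  ultimately show ?thesis by simp
qed

text \<open>The least r-set of positive integers avoiding 2 and 3 is {1, 4, ..., r + 2}, so it lies
  below \<open>A\<close>.\<close>

lemma compressed_without_23:
  assumes F: "compressed n r F" "F \<subseteq> nsets {1..n} r" "A \<in> F" and "2 \<notin> A" "3 \<notin> A" "r \<ge> 1"
  shows "insert 1 {4..r+2} \<in> F"
proof -
  have A: "finite A" "card A = r" "A \<subseteq> {1..n}" using F nsets_fin[of A n r] by auto
  have "(if i = 0 then 1 else i + 3) \<le> sorted_list_of_set A ! i" if "i < r" for i
  proof -
    let ?y = "sorted_list_of_set A ! i"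
    have *: "a = 1 \<or> 4 \<le> a" if "a \<in> A" for a
    proof -
      have "a \<noteq> 0" "a \<noteq> 2" "a \<noteq> 3" using that A assms by auto
      thus ?thesis by linarith
    qed
    have "A \<inter> {..?y} \<subseteq> insert 1 {4..?y}"
    proof
      fix a assume "a \<in> A \<inter> {..?y}"
      with *[of a] show "a \<in> insert 1 {4..?y}" by auto
    qed
    hence "card (A \<inter> {..?y}) \<le> card (insert 1 {4..?y})" by (intro card_mono) auto
    also have "\<dots> \<le> Suc (card {4..?y})" by (rule card_insert_le_m1) auto
    \<comment> \<open>Subtraction is truncated: for \<open>i > 0\<close> this gives
      \<open>i + 3 \<le> ?y\<close>, but for \<open>i = 0\<close> it says nothing, so
      \<open>1 \<le> ?y\<close> is shown separately.\<close>
    finally have "i \<le> ?y - 3" using nth_card_le[of A i] A that by simp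
    moreover have "?y \<in> set (sorted_list_of_set A)" using that A by (intro nth_mem) auto
    hence "1 \<le> ?y" using A by auto
    ultimately show ?thesis by auto
  qed
  hence "(\<lambda>i. if i = 0 then 1 else i + 3) ` {..<r} \<in> F"
    by (intro compressed_imageI[OF F]) (auto simp: strict_mono_def)
  moreover have "(\<lambda>i. if i = 0 then 1 else i + 3) ` {..<r} = insert 1 {4..r+2}"
  proof (intro equalityI subsetI)
    fix y assume "y \<in> insert 1 {4..r+2}"
    thus "y \<in> (\<lambda>i. if i = 0 then 1 else i + 3) ` {..<r}"
      using assms(6) by (intro image_eqI[of _ _ "if y = 1 then 0 else y - 3"]) (auto split: if_splits)
  qed (auto split: if_splits)
  ultimately show ?thesis by simp
qed

section \<open>Counting\<close>

text \<open>Deleting \<open>P\<close> is a bijection onto the subsets of \<open>V - P - Q\<close> of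
  size \<open>r - card P\<close>. The exact counts below all have this form: \<open>P\<close>
  prescribed, \<open>Q\<close> forbidden.\<close>

lemma card_nsets_between:
  assumes V: "finite V" and PQ: "P \<subseteq> V" "Q \<subseteq> V" "P \<inter> Q = {}" and "card P \<le> r"
  shows "card {A \<in> nsets V r. P \<subseteq> A \<and> A \<inter> Q = {}} = (card V - card P - card Q) choose (r - card P)"
proof -
  have fin: "finite P" "finite Q" using V PQ by (auto intro: finite_subset)
  have "bij_betw (\<lambda>B. B \<union> P) (nsets (V - P - Q) (r - card P)) {A \<in> nsets V r. P \<subseteq> A \<and> A \<inter> Q = {}}"
  proof (rule bij_betw_byWitness[where f' = "\<lambda>A. A - P"])
    show "(\<lambda>B. B \<union> P) ` nsets (V - P - Q) (r - card P) \<subseteq> {A \<in> nsets V r. P \<subseteq> A \<and> A \<inter> Q = {}}"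
    proof
      fix A assume "A \<in> (\<lambda>B. B \<union> P) ` nsets (V - P - Q) (r - card P)"
      then obtain B where B: "A = B \<union> P" "B \<subseteq> V - P - Q" "finite B" "card B = r - card P"
        by (auto simp: nsets_def)
      have "card (B \<union> P) = card B + card P" by (rule card_Un_disjoint) (use B fin in auto)
      hence "card A = r" using assms B by simp
      thus "A \<in> {A \<in> nsets V r. P \<subseteq> A \<and> A \<inter> Q = {}}" using B fin PQ by (auto simp: nsets_def)
    qed
    show "(\<lambda>A. A - P) ` {A \<in> nsets V r. P \<subseteq> A \<and> A \<inter> Q = {}} \<subseteq> nsets (V - P - Q) (r - card P)"
      using fin by (auto simp: nsets_def card_Diff_subset)
    show "\<forall>B\<in>nsets (V - P - Q) (r - card P). B \<union> P - P = B"
      unfolding nsets_def by blast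
    show "\<forall>A\<in>{A \<in> nsets V r. P \<subseteq> A \<and> A \<inter> Q = {}}. A - P \<union> P = A"
      by blast
  qed
  hence "card {A \<in> nsets V r. P \<subseteq> A \<and> A \<inter> Q = {}} = card (nsets (V - P - Q) (r - card P))"
    by (rule bij_betw_same_card[symmetric])
  also have "\<dots> = (card (V - P - Q)) choose (r - card P)" by (rule card_nsets)
  also have "card (V - P - Q) = card V - card P - card Q"
  proof -
    have "card (V - P - Q) = card (V - P) - card Q"
      by (rule card_Diff_subset) (use fin PQ in auto)
    moreover have "card (V - P) = card V - card P"
      by (rule card_Diff_subset) (use fin PQ in auto)
    ultimately show ?thesis by simp
  qed
  finally show ?thesis .
qed

section \<open>Binomial estimates\<close>

text \<open>Apply Pascal's rule \<open>j\<close> times; each time the dropped term is at most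
  \<open>(m - 1) choose (k - 1)\<close>. It bounds from below the number of star sets that
  \<open>F\<close> loses.\<close>

lemma choose_shift_lower:
  assumes "k \<ge> 1" "j \<le> m"
  shows "m choose k \<le> ((m - j) choose k) + j * ((m - 1) choose (k - 1))"
  using assms(2)
proof (induction j)
  case (Suc j)
  have "(m - j) choose k = ((m - Suc j) choose (k-1)) + ((m - Suc j) choose k)"
    using Suc.prems assms(1) by (subst choose_reduce_nat) (auto simp: add.commute)
  moreover have "(m - Suc j) choose (k-1) \<le> (m - 1) choose (k-1)"
    by (rule binomial_right_mono) simp
  moreover have "m choose k \<le> ((m - j) choose k) + j * ((m - 1) choose (k - 1))"
    using Suc by simp
  ultimately show ?case by simp
qed simp

text \<open>With \<open>k = m + 2\<close> this bounds \<open>(2*k-2) choose k\<close> by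
  \<open>4 ^ (k-2)\<close>. Equality holds at \<open>m = 0\<close>, and successive values have ratio
  (2m + 4)(2m + 3) / ((m + 3)(m + 1)), which is at most 4.\<close>

lemma central_choose_le: "(2 * m + 2) choose (m + 2) \<le> 4 ^ m"
proof (induction m)
  case (Suc m)
  have e: "Suc (m+2) = m+3" "Suc (2*m+3) = 2*m+4" "2*m+3 - (m+2) = m+1" "2*m+3 - 1 = 2*m+2"
    by simp_all
  have "(m+3) * (m+1) * ((2*m+4) choose (m+3)) = (m+1) * ((m+3) * ((2*m+4) choose (m+3)))"
    by (simp only: mult_ac)
  also have "\<dots> = (2*m+4) * ((m+1) * ((2*m+3) choose (m+2)))"
    unfolding Suc_times_binomial[of "m+2" "2*m+3", unfolded e] by (simp only: mult_ac)
  also have "(m+1) * ((2*m+3) choose (m+2)) = (2*m+3) * ((2*m+2) choose (m+2))"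
    by (rule binomial_absorb_comp[of "2*m+3" "m+2", unfolded e])
  finally have "(m+3) * (m+1) * ((2*m+4) choose (m+3)) = (2*m+4) * (2*m+3) * ((2*m+2) choose (m+2))"
    by (simp only: mult.assoc)
  also have "\<dots> \<le> (4 * ((m+3)*(m+1))) * 4 ^ m"
    by (rule mult_mono) (use Suc in \<open>auto simp: algebra_simps\<close>)
  finally have "(m+3) * (m+1) * ((2*m+4) choose (m+3)) \<le> (m+3) * (m+1) * 4 ^ Suc m"
    by (simp only: power_Suc mult_ac)
  hence "(2*m+4) choose (m+3) \<le> 4 ^ Suc m"
    by (rule mult_left_le_imp_le[where c = "(m+3) * (m+1)"]) simp
  thus ?case by (simp add: numeral_eq_Suc)
qed simp

text \<open>The exact ratio is (r - k)/(n - 1 - k). It is at most r/n iff r(1 + k) \<le> nk, which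
  follows from 1 + k \<le> 2k and 2r \<le> n.\<close>

lemma choose_ratio:
  assumes "2 * r \<le> n" "k < r" "1 \<le> k"
  shows "real ((n - 2 - k) choose (r - k - 1)) \<le> real r / real n * real ((n - 1 - k) choose (r - k))"
proof -
  let ?b = "(n - 2 - k) choose (r - k - 1)" and ?a = "(n - 1 - k) choose (r - k)"
  have eq0: "(r - k) * ?a = (n - 1 - k) * ?b"
    using Suc_times_binomial_eq[of "n-2-k" "r-k-1"] assms
    by (simp add: algebra_simps Suc_diff_Suc numeral_2_eq_2)
  hence eq: "(real r - real k) * real ?a = (real n - 1 - real k) * real ?b"
  proof -
    have "real ((r - k) * ?a) = real ((n - 1 - k) * ?b)" using eq0 by simp
    moreover have "real (r - k) = real r - real k" "real (n - 1 - k) = real n - 1 - real k"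
      using assms by auto
    ultimately show ?thesis by simp
  qed
  have nk: "real n - 1 - real k > 0" using assms by linarith
  have "r * (1 + k) \<le> n * k"
  proof -
    have "r * (1 + k) \<le> r * (2 * k)" using assms by (intro mult_left_mono) auto
    also have "\<dots> = (2 * r) * k" by simp
    also have "\<dots> \<le> n * k" using assms by (intro mult_right_mono) auto
    finally show ?thesis .
  qed
  hence "real r * (1 + real k) \<le> real n * real k"
    by (metis of_nat_mult of_nat_add of_nat_1 of_nat_le_iff)
  hence "(real r - real k) * real n \<le> real r * (real n - 1 - real k)" by (simp add: algebra_simps)
  hence "real n * ((real n - 1 - real k) * real ?b) \<le> real r * (real n - 1 - real k) * real ?a"
    unfolding eq[symmetric] using mult_right_mono[of _ _ "real ?a"] by (fastforce simp: algebra_simps)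
  hence "(real n - 1 - real k) * (real n * real ?b) \<le> (real n - 1 - real k) * (real r * real ?a)"
    by (simp add: algebra_simps)
  hence "real n * real ?b \<le> real r * real ?a" using nk by (simp add: mult_le_cancel_left)
  thus ?thesis using assms by (simp add: field_simps)
qed

text \<open>Iterating the previous ratio puts all later counts on the scale of
  \<open>(n - 3) choose (r - 2)\<close>; the case \<open>m = 1\<close> becomes
  \<open>c \<le> q * b\<close> below.\<close>

lemma choose_ratio_power:
  assumes "2 * r \<le> n" "m + 2 \<le> r"
  shows "real ((n - 3 - m) choose (r - 2 - m)) \<le> (real r / real n) ^ m * real ((n - 3) choose (r - 2))"
  using assms(2)
proof (induction m)
  case (Suc m)
  have "real ((n - 3 - Suc m) choose (r - 2 - Suc m)) \<le> real r / real n * real ((n - 3 - m) choose (r - 2 - m))"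
    using choose_ratio[of r n "m+2"] assms Suc.prems by (simp add: numeral_eq_Suc)
  also have "\<dots> \<le> real r / real n * ((real r / real n) ^ m * real ((n - 3) choose (r - 2)))"
    using Suc by (intro mult_left_mono) auto
  finally show ?case by (simp add: mult_ac)
qed simp

section \<open>Members of the family avoiding 1\<close>

text \<open>The shape that \<open>compressed_intersecting_dense\<close> leaves for members avoiding
  1. Starting the interval at 2 leaves 2k - 2 places: none for k = 1, and only 2 and 3 for k =
  2.\<close>

definition dense_sets :: "nat \<Rightarrow> nat \<Rightarrow> nat \<Rightarrow> nat set set" where
  "dense_sets n r k = {A \<in> nsets {1..n} r. 1 \<notin> A \<and> k \<le> card (A \<inter> {2..2*k-1})}"

lemma finite_dense_sets: "finite (dense_sets n r k)"
  unfolding dense_sets_def by (simp add: finite_imp_finite_nsets)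

text \<open>Union bound over \<open>k\<close> elements \<open>P\<close> chosen in the interval; the
  other \<open>r - k\<close> elements come from outside \<open>P\<close> and 1.\<close>

lemma card_dense_sets:
  assumes "1 \<le> k" "k \<le> r" "2 * r \<le> n"
  shows "card (dense_sets n r k) \<le> ((2*k-2) choose k) * ((n-1-k) choose (r-k))"
proof -
  let ?S = "\<lambda>P. {A \<in> nsets {1..n} r. P \<subseteq> A \<and> A \<inter> {1} = {}}"
  have "dense_sets n r k \<subseteq> (\<Union>P\<in>nsets {2..2*k-1} k. ?S P)"
  proof
    fix A assume A: "A \<in> dense_sets n r k"
    then obtain P where "P \<subseteq> A \<inter> {2..2*k-1}" "card P = k" "finite P"
      by (metis (mono_tags, lifting) dense_sets_def mem_Collect_eq obtain_subset_with_card_n)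
    thus "A \<in> (\<Union>P\<in>nsets {2..2*k-1} k. ?S P)"
      using A by (auto simp: dense_sets_def nsets_def)
  qed
  hence "card (dense_sets n r k) \<le> card (\<Union>P\<in>nsets {2..2*k-1} k. ?S P)"
    by (intro card_mono) (auto simp: finite_imp_finite_nsets)
  also have "\<dots> \<le> (\<Sum>P\<in>nsets {2..2*k-1} k. card (?S P))"
    by (rule card_UN_le) (simp add: finite_imp_finite_nsets)
  also have "\<dots> = (\<Sum>P\<in>nsets {2..2*k-1} k. (n-1-k) choose (r-k))"
  proof (rule sum.cong)
    fix P assume "P \<in> nsets {2..2*k-1} k"
    hence P: "P \<subseteq> {2..2*k-1}" "card P = k" by (auto simp: nsets_def)
    have "{2..2*k-1} \<subseteq> {1..n}" using assms by auto
    with P(1) have "P \<subseteq> {1..n}" by blast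
    moreover have "P \<inter> {1} = {}" using P(1) by auto
    ultimately have "card (?S P) = (card {1..n} - card P - card {1::nat}) choose (r - card P)"
      using assms P by (intro card_nsets_between) auto
    thus "card (?S P) = (n-1-k) choose (r-k)" using P by (simp add: algebra_simps)
  qed simp
  also have "\<dots> = ((2*k-2) choose k) * ((n-1-k) choose (r-k))"
    using assms by (simp add: card_nsets)
  finally show ?thesis .
qed

text \<open>With q = r/n, the index \<open>k\<close> contributes at most (4q)^(k-2) times the
  binomial coefficient. Since 4q \<le> 1/5, the geometric series sums to at most 5/4 times
  4q.\<close>

lemma card_UN_dense_sets:
  assumes "3 \<le> r" "20 * r \<le> n"
  shows "real (card (\<Union>k\<in>{3..r}. dense_sets n r k)) \<le> 5 * (real r / real n) * real ((n-3) choose (r-2))"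
proof -
  let ?q = "real r / real n" and ?b = "real ((n-3) choose (r-2))"
  have q: "0 \<le> ?q" "?q \<le> 1/20" using assms by (auto simp: field_simps)
  have "card (\<Union>k\<in>{3..r}. dense_sets n r k) \<le> (\<Sum>k\<in>{3..r}. card (dense_sets n r k))"
    by (rule card_UN_le) simp
  hence "real (card (\<Union>k\<in>{3..r}. dense_sets n r k)) \<le> (\<Sum>k\<in>{3..r}. real (card (dense_sets n r k)))"
    by (metis of_nat_le_iff of_nat_sum)
  also have "\<dots> \<le> (\<Sum>k\<in>{3..r}. (4 * ?q) ^ (k-2) * ?b)"
  proof (rule sum_mono)
    fix k assume k: "k \<in> {3..r}"
    define m where "m = k - 2"
    have km: "k = m + 2" using k by (auto simp: m_def)
    have "real (card (dense_sets n r k)) \<le> real ((2*k-2) choose k) * real ((n-1-k) choose (r-k))"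
    proof -
      have "card (dense_sets n r k) \<le> ((2*k-2) choose k) * ((n-1-k) choose (r-k))"
        using k assms by (intro card_dense_sets) auto
      thus ?thesis by (metis of_nat_le_iff of_nat_mult)
    qed
    also have "\<dots> \<le> 4 ^ m * (?q ^ m * ?b)"
    proof (rule mult_mono)
      have "(2*k-2) choose k \<le> 4 ^ m" using central_choose_le[of m] by (simp add: km)
      thus "real ((2*k-2) choose k) \<le> 4 ^ m" by (metis of_nat_le_iff of_nat_numeral of_nat_power)
      show "real ((n-1-k) choose (r-k)) \<le> ?q ^ m * ?b"
      proof -
        have "n - 3 - m = n - 1 - k" "r - 2 - m = r - k" using km by auto
        with choose_ratio_power[of r n m] k assms km show ?thesis by simp
      qed
    qed auto
    also have "\<dots> = (4 * ?q) ^ m * ?b" by (simp only: power_mult_distrib mult.assoc)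
    finally show "real (card (dense_sets n r k)) \<le> (4 * ?q) ^ (k-2) * ?b" by (simp add: km)
  qed
  also have "\<dots> = (\<Sum>k\<in>{3..r}. (4 * ?q) ^ (k-2)) * ?b" by (simp add: sum_distrib_right)
  also have "\<dots> \<le> (5 * ?q) * ?b"
  proof (rule mult_right_mono)
    have "(\<Sum>k\<in>{3..r}. x ^ (k-2)) \<le> 5/4 * x" if x: "0 \<le> x" "x \<le> 1/5" for x :: real
    proof -
      \<comment> \<open>The factor 5/4 bounds 1/(1 - x), and the subtracted power of
        \<open>x\<close> makes the bound inductive.\<close>
      have "(\<Sum>k\<in>{3..j+2}. x ^ (k-2)) \<le> 5/4 * x - 5/4 * x ^ Suc j" for j
      proof (induction j)
        case (Suc j)
        have "(\<Sum>k\<in>{3..Suc j+2}. x ^ (k-2)) = x ^ Suc j + (\<Sum>k\<in>{3..j+2}. x ^ (k-2))"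
          using sum.nat_ivl_Suc'[of 3 "j+2" "\<lambda>k. x ^ (k-2)"] by simp
        moreover have "x * x ^ Suc j \<le> 1/5 * x ^ Suc j"
          using x by (intro mult_right_mono) auto
        ultimately show ?case using Suc unfolding power_Suc[of x "Suc j"] by linarith
      qed simp
      from this[of "r-2"] have "(\<Sum>k\<in>{3..r}. x ^ (k-2)) \<le> 5/4 * x - 5/4 * x ^ (r-1)"
        using assms by (simp add: numeral_2_eq_2 Suc_diff_Suc flip: power_Suc)
      moreover have "0 \<le> x ^ (r-1)" using x by simp
      ultimately show ?thesis by linarith
    qed
    from this[of "4 * ?q"] q show "(\<Sum>k\<in>{3..r}. (4 * ?q) ^ (k-2)) \<le> 5 * ?q" by simp
  qed simp
  finally show ?thesis .
qed

lemma avoiding_1_cases: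
  assumes F: "compressed n r F" "F \<subseteq> nsets {1..n} r" "intersecting F"
    and A: "A \<in> F" "1 \<notin> A"
  shows "{2,3} \<subseteq> A \<or> A \<in> (\<Union>k\<in>{3..r}. dense_sets n r k)"
proof -
  obtain k where k: "k \<in> {1..r}" "k \<le> card (A \<inter> {1..2*k-1})"
    using compressed_intersecting_dense[OF F A(1)] by blast
  have sub: "A \<inter> {1..2*k-1} = A \<inter> {2..2*k-1}"
  proof
    show "A \<inter> {1..2*k-1} \<subseteq> A \<inter> {2..2*k-1}"
    proof
      fix a assume a: "a \<in> A \<inter> {1..2*k-1}"
      hence "a \<noteq> 1" using A by auto
      with a show "a \<in> A \<inter> {2..2*k-1}" by auto
    qed
  qed auto
  consider "k = 1" | "k = 2" | "3 \<le> k" using k by force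
  thus ?thesis
  proof cases
    case 1
    thus ?thesis using k A by simp
  next
    case 2
    have "{2..3} = {2,3::nat}" by auto
    hence "card {2,3::nat} \<le> card (A \<inter> {2,3})" using k(2) 2 unfolding sub by simp
    hence "A \<inter> {2,3} = {2,3}" by (intro card_seteq) auto
    thus ?thesis by blast
  next
    case 3
    hence "A \<in> dense_sets n r k" using k A F(2) unfolding sub dense_sets_def by auto
    thus ?thesis using 3 k by auto
  qed
qed

text \<open>Exchange argument: the sets that \<open>F\<close> gains over the star are its members
  avoiding 1 and meeting \<open>X\<close>, and \<open>L\<close> consists of star sets that it loses.
  It suffices that the losses are at least as many as the gains.\<close>

lemma card_hitting_le:
  assumes F: "F \<subseteq> nsets {1..n} r"
    and L: "L \<subseteq> hitting (star n r) X" "L \<inter> F = {}"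
    and G: "card {A \<in> F. 1 \<notin> A \<and> A \<inter> X \<noteq> {}} \<le> card L"
  shows "card (hitting F X) \<le> card (hitting (star n r) X)"
proof -
  let ?G = "{A \<in> F. 1 \<notin> A \<and> A \<inter> X \<noteq> {}}" and ?S = "{A \<in> F. 1 \<in> A \<and> A \<inter> X \<noteq> {}}"
  have finN: "finite (nsets {1..n} r)" by (simp add: finite_imp_finite_nsets)
  have fin: "finite F" "finite (hitting (star n r) X)"
    using finN F by (auto intro: finite_subset simp: hitting_def star_def)
  have "hitting F X = ?S \<union> ?G" by (auto simp: hitting_def)
  hence "card (hitting F X) \<le> card ?S + card ?G" by (simp add: card_Un_le)
  also have "\<dots> \<le> card ?S + card L" using G by simp
  also have "\<dots> = card (?S \<union> L)"
    using L fin finite_subset by (intro card_Un_disjoint[symmetric]) auto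
  also have "\<dots> \<le> card (hitting (star n r) X)"
    using fin L F by (intro card_mono) (auto simp: hitting_def star_def)
  finally show ?thesis .
qed

section \<open>Comparison with the star\<close>

text \<open>Gains containing {2, 3} also meet \<open>Y\<close>, so there are at most |Y| c + 5qb
  gains. If there is any gain, \<open>{2..r+1}\<close> is in \<open>F\<close>, so all sets
  containing 1 and \<open>x\<close> but missing [2, r + 1] are lost: at least b - (r - 1)c of them.
  As c \<le> qb, it suffices that (r + 4 + |Y|) q \<le> 1.\<close>

lemma hitting_le_star_of_cover:
  assumes F: "compressed n r F" "F \<subseteq> nsets {1..n} r" "intersecting F"
    and r: "3 \<le> r" "20 * r \<le> n" "(r + 4 + card Y) * r \<le> n"
    and x: "x \<in> X" "r + 2 \<le> x" "x \<le> n"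
    and Y: "Y \<subseteq> {4..n}"
    and cover: "\<And>A. A \<in> F \<Longrightarrow> 1 \<notin> A \<Longrightarrow> A \<inter> X \<noteq> {} \<Longrightarrow> {2,3} \<subseteq> A \<Longrightarrow> A \<inter> Y \<noteq> {}"
  shows "card (hitting F X) \<le> card (hitting (star n r) X)"
proof (cases "\<forall>A\<in>F. 1 \<in> A")
  case True
  hence "{A \<in> F. 1 \<notin> A \<and> A \<inter> X \<noteq> {}} = {}" by blast
  hence "card {A \<in> F. 1 \<notin> A \<and> A \<inter> X \<noteq> {}} \<le> card ({} :: nat set set)" by (simp only: order.refl)
  with card_hitting_le[OF F(2) empty_subsetI] show ?thesis by blast
next
  case False
  hence init: "{2..r+1} \<in> F" using compressed_without_1[OF F(1,2)] by blast
  let ?D = "\<Union>k\<in>{3..r}. dense_sets n r k"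
  let ?G = "{A \<in> F. 1 \<notin> A \<and> A \<inter> X \<noteq> {}}"
  let ?S = "\<lambda>y. {A \<in> nsets {1..n} r. {2,3,y} \<subseteq> A \<and> A \<inter> {1} = {}}"
  let ?L = "{A \<in> nsets {1..n} r. {1,x} \<subseteq> A \<and> A \<inter> {2..r+1} = {}}"
  define b where "b = real ((n-3) choose (r-2))"
  define c where "c = real ((n-4) choose (r-3))"
  define q where "q = real r / real n"
  have finY: "finite Y" using Y finite_subset by blast
  have c: "c \<le> q * b" using choose_ratio_power[of r n 1] r by (simp add: b_def c_def q_def)
  have D: "real (card ?D) \<le> 5 * q * b" using card_UN_dense_sets[of r n] r by (simp add: b_def q_def)
  have "?G \<subseteq> (\<Union>y\<in>Y. ?S y) \<union> ?D"
  proof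
    fix A assume A: "A \<in> ?G"
    hence "{2,3} \<subseteq> A \<or> A \<in> ?D" using avoiding_1_cases[OF F] by blast
    thus "A \<in> (\<Union>y\<in>Y. ?S y) \<union> ?D" using A F(2) cover[of A] by blast
  qed
  hence "card ?G \<le> card ((\<Union>y\<in>Y. ?S y) \<union> ?D)"
    using finY by (intro card_mono) (auto simp: finite_imp_finite_nsets finite_dense_sets)
  also have "\<dots> \<le> card (\<Union>y\<in>Y. ?S y) + card ?D" by (rule card_Un_le)
  also have "card (\<Union>y\<in>Y. ?S y) \<le> (\<Sum>y\<in>Y. card (?S y))" using finY by (rule card_UN_le)
  also have "\<dots> = (\<Sum>y\<in>Y. (n-4) choose (r-3))"
  proof (rule sum.cong)
    fix y assume "y \<in> Y"
    hence y: "4 \<le> y" "y \<le> n" using Y by auto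
    hence "card {2,3,y} = 3" by simp
    moreover have "card (?S y) = (card {1..n} - card {2,3,y} - card {1::nat}) choose (r - card {2,3,y})"
      using y r \<open>card {2,3,y} = 3\<close> by (intro card_nsets_between) auto
    ultimately show "card (?S y) = (n-4) choose (r-3)" by simp
  qed simp
  finally have "card ?G \<le> card Y * ((n-4) choose (r-3)) + card ?D" by simp
  hence "real (card ?G) \<le> real (card Y * ((n-4) choose (r-3)) + card ?D)" by (rule of_nat_mono)
  hence G: "real (card ?G) \<le> real (card Y) * c + 5 * q * b" using D by (simp add: c_def)
  have "card ?L = (n-2-r) choose (r-2)"
  proof -
    have "card {1,x} = 2" using x by simp
    moreover have "card ?L = (card {1..n} - card {1,x} - card {2..r+1}) choose (r - card {1,x})"
      using x r \<open>card {1,x} = 2\<close> by (intro card_nsets_between) auto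
    ultimately show ?thesis by simp
  qed
  moreover have "(n-3) choose (r-2) \<le> ((n-2-r) choose (r-2)) + (r-1) * ((n-4) choose (r-3))"
  proof -
    have e: "n - 3 - (r - 1) = n - 2 - r" "n - 3 - 1 = n - 4" "r - 2 - 1 = r - 3" using r by auto
    show ?thesis using choose_shift_lower[of "r-2" "r-1" "n-3"] r unfolding e by simp
  qed
  hence "b \<le> real (((n-2-r) choose (r-2)) + (r-1) * ((n-4) choose (r-3)))"
    unfolding b_def by (rule of_nat_mono)
  hence "b \<le> real ((n-2-r) choose (r-2)) + (real r - 1) * c" using r by (simp add: c_def)
  ultimately have L: "b - (real r - 1) * c \<le> real (card ?L)" by simp
  have "(real r + 4 + real (card Y)) * real r \<le> real n"
    using r(3) by (metis of_nat_add of_nat_le_iff of_nat_mult of_nat_numeral)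
  hence q: "(real r + 4 + real (card Y)) * q \<le> 1" using r by (simp add: q_def field_simps)
  have "real (card Y) * c + 5 * q * b + (real r - 1) * c = (real r - 1 + real (card Y)) * c + 5 * q * b"
    by (simp add: algebra_simps)
  also have "\<dots> \<le> (real r - 1 + real (card Y)) * (q * b) + 5 * q * b"
    using c r by (intro add_right_mono mult_left_mono) auto
  also have "\<dots> = (real r + 4 + real (card Y)) * q * b" by (simp add: algebra_simps)
  also have "\<dots> \<le> 1 * b" using q by (intro mult_right_mono) (auto simp: b_def)
  finally have "real (card ?G) \<le> real (card ?L)" using G L by linarith
  hence "card ?G \<le> card ?L" by simp
  moreover have "?L \<subseteq> hitting (star n r) X" using x by (auto simp: hitting_def star_def)
  moreover have "?L \<inter> F = {}" using init F(3) unfolding intersecting_def by blast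
  ultimately show ?thesis by (intro card_hitting_le[OF F(2), of ?L])
qed

text \<open>There are at most b + 5qb gains. By \<open>tri\<close>, all sets containing 1 and one of
  \<open>y\<close>, \<open>z\<close> but missing {2, 3} are lost, at least 2b - 3c of them. Since c
  \<le> qb, it suffices that 8q \<le> 1.\<close>

lemma hitting_le_star_of_triangle:
  assumes F: "compressed n r F" "F \<subseteq> nsets {1..n} r" "intersecting F"
    and r: "3 \<le> r" "20 * r \<le> n"
    and X: "y \<in> X" "z \<in> X" "y \<noteq> z" "y \<in> {4..n}" "z \<in> {4..n}"
    and tri: "\<And>A. A \<in> F \<Longrightarrow> 1 \<in> A \<Longrightarrow> 2 \<in> A \<or> 3 \<in> A"
  shows "card (hitting F X) \<le> card (hitting (star n r) X)"
proof -
  let ?D = "\<Union>k\<in>{3..r}. dense_sets n r k"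
  let ?G = "{A \<in> F. 1 \<notin> A \<and> A \<inter> X \<noteq> {}}"
  let ?S = "{A \<in> nsets {1..n} r. {2,3} \<subseteq> A \<and> A \<inter> {1} = {}}"
  let ?L1 = "{A \<in> nsets {1..n} r. {1,y} \<subseteq> A \<and> A \<inter> {2,3} = {}}"
  \<comment> \<open>Excluding \<open>y\<close> keeps \<open>?L2\<close> disjoint from
    \<open>?L1\<close>.\<close>
  let ?L2 = "{A \<in> nsets {1..n} r. {1,z} \<subseteq> A \<and> A \<inter> {2,3,y} = {}}"
  define b where "b = real ((n-3) choose (r-2))"
  define c where "c = real ((n-4) choose (r-3))"
  define q where "q = real r / real n"
  have c: "c \<le> q * b" using choose_ratio_power[of r n 1] r by (simp add: b_def c_def q_def)
  have D: "real (card ?D) \<le> 5 * q * b" using card_UN_dense_sets[of r n] r by (simp add: b_def q_def)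
  have "?G \<subseteq> ?S \<union> ?D" using avoiding_1_cases[OF F] F(2) by blast
  hence "card ?G \<le> card (?S \<union> ?D)"
    by (intro card_mono) (auto simp: finite_imp_finite_nsets finite_dense_sets)
  also have "\<dots> \<le> card ?S + card ?D" by (rule card_Un_le)
  also have "card ?S = (card {1..n} - card {2,3::nat} - card {1::nat}) choose (r - card {2,3::nat})"
    using r by (intro card_nsets_between) auto
  also have "\<dots> = (n-3) choose (r-2)" by (simp add: numeral_3_eq_3 numeral_2_eq_2)
  finally have "card ?G \<le> ((n-3) choose (r-2)) + card ?D" .
  hence "real (card ?G) \<le> real (((n-3) choose (r-2)) + card ?D)" by (rule of_nat_mono)
  hence G: "real (card ?G) \<le> b + 5 * q * b" using D by (simp add: b_def)
  have e: "n - 3 - 1 = n - 4" "r - 2 - 1 = r - 3" "n - 3 - 2 = n - 5" by auto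
  have "card {1,y} = 2" "card {1,z} = 2" "card {2,3,y} = 3" using X by auto
  have "card ?L1 = (card {1..n} - card {1,y} - card {2,3::nat}) choose (r - card {1,y})"
    using X r \<open>card {1,y} = 2\<close> by (intro card_nsets_between) auto
  hence L1: "card ?L1 = (n-4) choose (r-2)" using \<open>card {1,y} = 2\<close> by simp
  have "card ?L2 = (card {1..n} - card {1,z} - card {2,3,y}) choose (r - card {1,z})"
    using X r \<open>card {1,z} = 2\<close> by (intro card_nsets_between) auto
  hence L2: "card ?L2 = (n-5) choose (r-2)" using \<open>card {1,z} = 2\<close> \<open>card {2,3,y} = 3\<close> by simp
  have "(n-3) choose (r-2) \<le> card ?L1 + 1 * ((n-4) choose (r-3))"
    using choose_shift_lower[of "r-2" 1 "n-3"] r unfolding L1 e by simp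
  hence "b \<le> real (card ?L1 + 1 * ((n-4) choose (r-3)))" unfolding b_def by (rule of_nat_mono)
  hence b1: "b \<le> real (card ?L1) + c" by (simp add: c_def)
  have "(n-3) choose (r-2) \<le> card ?L2 + 2 * ((n-4) choose (r-3))"
    using choose_shift_lower[of "r-2" 2 "n-3"] r unfolding L2 e by simp
  hence "b \<le> real (card ?L2 + 2 * ((n-4) choose (r-3)))" unfolding b_def by (rule of_nat_mono)
  hence b2: "b \<le> real (card ?L2) + 2 * c" by (simp add: c_def)
  have "card (?L1 \<union> ?L2) = card ?L1 + card ?L2"
    by (intro card_Un_disjoint) (auto simp: finite_imp_finite_nsets)
  hence L: "2 * b - 3 * c \<le> real (card (?L1 \<union> ?L2))" using b1 b2 by simp
  have "8 * q \<le> 1" using r by (simp add: q_def field_simps)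
  hence "8 * q * b \<le> 1 * b" by (intro mult_right_mono) (auto simp: b_def)
  hence "b + 5 * q * b + 3 * c \<le> 2 * b" using c by linarith
  hence "card ?G \<le> card (?L1 \<union> ?L2)" using G L by linarith
  moreover have "?L1 \<union> ?L2 \<subseteq> hitting (star n r) X" using X by (auto simp: hitting_def star_def)
  moreover have "(?L1 \<union> ?L2) \<inter> F = {}" by (auto dest: tri)
  ultimately show ?thesis by (intro card_hitting_le[OF F(2), of "?L1 \<union> ?L2"])
qed

text \<open>Every gain meets \<open>X\<close> by definition, and \<open>X\<close> lies in [4, n], so
  \<open>X\<close> itself serves as the cover \<open>Y\<close>.\<close>

lemma EKR_avoiding_23:
  assumes "X \<subseteq> {2..n}" "X \<inter> {2,3} = {}" "\<not> X \<subseteq> {2..r+1}"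
    and "3 \<le> r" "20 * r \<le> n" "(r + 4 + card X) * r \<le> n"
  shows "EKR n r X"
  unfolding EKR_def
proof (intro conjI allI impI)
  fix F assume F: "F \<subseteq> nsets {1..n} r" "compressed n r F \<and> intersecting F"
  obtain x where x: "x \<in> X" "x \<notin> {2..r+1}" using assms by blast
  hence "x \<in> {2..n}" using assms(1) by blast
  with x have "r + 2 \<le> x" "x \<le> n" by auto
  moreover have "X \<subseteq> {4..n}"
  proof
    fix a assume "a \<in> X"
    hence "a \<in> {2..n}" "a \<noteq> 2" "a \<noteq> 3" using assms by auto
    thus "a \<in> {4..n}" by auto
  qed
  ultimately show "card (hitting F X) \<le> card (hitting (star n r) X)"
    using F assms x by (intro hitting_le_star_of_cover[where Y = X and x = x]) auto
qed (rule assms)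

lemma EKR_two_outside_23:
  assumes X: "X \<subseteq> {2..n}" "2 \<le> card (X - {2,3})" "\<not> X \<subseteq> {2..r+1}"
    and r: "3 \<le> r" "20 * r \<le> n" "(2 * r + 3) * r \<le> n"
  shows "EKR n r X"
  unfolding EKR_def
proof (intro conjI allI impI)
  fix F assume F: "F \<subseteq> nsets {1..n} r" "compressed n r F \<and> intersecting F"
  show "card (hitting F X) \<le> card (hitting (star n r) X)"
  proof (cases "\<forall>A\<in>F. 1 \<in> A \<longrightarrow> 2 \<in> A \<or> 3 \<in> A")
    case True
    have sub: "X - {2,3} \<subseteq> {4..n}"
    proof
      fix a assume "a \<in> X - {2,3}"
      hence "a \<in> {2..n}" "a \<noteq> 2" "a \<noteq> 3" using X by auto
      thus "a \<in> {4..n}" by auto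
    qed
    obtain T where "T \<subseteq> X - {2,3}" "card T = 2"
      using X(2) by (metis obtain_subset_with_card_n)
    then obtain y z where "y \<in> X - {2,3}" "z \<in> X - {2,3}" "y \<noteq> z"
      by (auto simp: card_2_iff)
    thus ?thesis
      using F True sub r by (intro hitting_le_star_of_triangle[where y = y and z = z]) auto
  next
    case False
    hence init: "insert 1 {4..r+2} \<in> F" using compressed_without_23[of n r F] F r by force
    obtain x where x: "x \<in> X" "x \<notin> {2..r+1}" using X by blast
    hence "x \<in> {2..n}" using X(1) by blast
    with x have "r + 2 \<le> x" "x \<le> n" by auto
    moreover have "A \<inter> {4..r+2} \<noteq> {}" if "A \<in> F" "1 \<notin> A" for A
      using that init F(2) unfolding intersecting_def by blast
    \<comment> \<open>The cover has r - 1 elements, whence the factor r + 4 + (r - 1) = 2r +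
      3.\<close>
    moreover have "(r + 4 + card {4..r+2}) * r \<le> n" using r by (simp add: algebra_simps)
    ultimately show ?thesis
      using F r x by (intro hitting_le_star_of_cover[where Y = "{4..r+2}" and x = x]) auto
  qed
qed (rule X)

section \<open>Sets that are not eventually EKR\<close>

text \<open>Disjoint sets share the \<open>m\<close> places of [m]. This shows that families defined
  by large counts are intersecting.\<close>

lemma card_initial_add_le:
  assumes "A \<subseteq> {1..n::nat}" "B \<subseteq> {1..n}" "A \<inter> B = {}"
  shows "card (A \<inter> {..m}) + card (B \<inter> {..m}) \<le> m"
proof -
  have "card (A \<inter> {..m}) + card (B \<inter> {..m}) = card ((A \<inter> {..m}) \<union> (B \<inter> {..m}))"
    using assms by (intro card_Un_disjoint[symmetric]) auto
  also have "\<dots> \<le> card {1..m}" using assms by (intro card_mono) auto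
  finally show ?thesis by simp
qed

text \<open>The Hilton--Milner family \<open>{A. 1 \<in> A \<and> A \<inter> [2, r + 1] \<noteq> {}} \<union> {[2, r + 1]}\<close>, written through
  counts of initial segments, which makes it evidently compressed.\<close>
lemma not_EKR_initial:
  assumes X: "X \<subseteq> {2..r+1}" "X \<noteq> {}" and r: "2 \<le> r" "r + 1 \<le> n"
  shows "\<not> EKR n r X"
proof
  assume "EKR n r X"
  define H where "H = {A \<in> nsets {1..n} r.
    (1 \<le> card (A \<inter> {..1}) \<and> 2 \<le> card (A \<inter> {..r+1})) \<or> r \<le> card (A \<inter> {..r+1})}"
  have "compressed n r H"
    unfolding compressed_def
  proof (intro ballI impI)
    fix A B assume AB: "A \<in> H" "B \<in> nsets {1..n} r" "compression_le B A"
    hence le: "card (A \<inter> {..m}) \<le> card (B \<inter> {..m})" for m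
      by (intro compression_le_card) (auto simp: H_def nsets_def)
    show "B \<in> H" using AB le[of 1] le[of "r+1"] unfolding H_def by auto
  qed
  moreover have "intersecting H"
    unfolding intersecting_def
  proof (intro ballI notI)
    fix A B assume AB: "A \<in> H" "B \<in> H" "A \<inter> B = {}"
    hence le: "card (A \<inter> {..m}) + card (B \<inter> {..m}) \<le> m" for m
      by (intro card_initial_add_le[of A n]) (auto simp: H_def nsets_def)
    have "1 \<le> card (C \<inter> {..1}) \<and> 2 \<le> card (C \<inter> {..r+1}) \<or> r \<le> card (C \<inter> {..r+1})" if "C \<in> H" for C
      using that by (simp only: H_def mem_Collect_eq)
    \<comment> \<open>Two members of the first kind violate the bound at 1; a mixed pair has 2 + r >
      r + 1, and two of the second kind have 2r > r + 1 because \<open>r \<ge> 2\<close>.\<close>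
    from this[OF AB(1)] this[OF AB(2)] le[of 1] le[of "r+1"] r show False by linarith
  qed
  moreover have "H \<subseteq> nsets {1..n} r" by (auto simp: H_def)
  ultimately have "card (hitting H X) \<le> card (hitting (star n r) X)"
    using \<open>EKR n r X\<close> unfolding EKR_def by blast
  \<comment> \<open>As \<open>X\<close> lies in [2, r + 1], a star set meeting \<open>X\<close> is
    already in \<open>H\<close>; the extra set [2, r + 1] also meets \<open>X\<close>.\<close>
  moreover have "hitting (star n r) X \<subset> hitting H X"
  proof
    show "hitting (star n r) X \<subseteq> hitting H X"
    proof
      fix A assume A: "A \<in> hitting (star n r) X"
      then obtain y where y: "y \<in> A" "y \<in> X" "1 \<in> A" by (auto simp: hitting_def star_def)
      hence "y \<in> {2..r+1}" using X by blast
      with y obtain x where x: "x \<in> A" "x \<in> X" "x \<noteq> 1" "x \<le> r + 1" "1 \<in> A" by auto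
      have "card {1,x} \<le> card (A \<inter> {..r+1})" using x by (intro card_mono) auto
      moreover have "card {1::nat} \<le> card (A \<inter> {..1})" using x by (intro card_mono) auto
      ultimately show "A \<in> hitting H X"
        using A x by (auto simp: hitting_def star_def H_def)
    qed
    have "{2..r+1} \<inter> {..r+1} = {2..r+1}" by auto
    hence "{2..r+1} \<in> hitting H X"
      using X r by (auto simp: hitting_def H_def nsets_def)
    moreover have "{2..r+1} \<notin> hitting (star n r) X" by (auto simp: hitting_def star_def)
    ultimately show "hitting (star n r) X \<noteq> hitting H X" by blast
  qed
  moreover have "finite (hitting H X)"
    by (simp add: hitting_def H_def finite_imp_finite_nsets)
  ultimately show False using psubset_card_mono by (metis leD)
qed

text \<open>The triangle family loses only star sets that miss {2, 3} and meet \<open>X\<close> in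
  \<open>x\<close>, at most \<open>(n-4) choose (r-2)\<close>. It gains all sets containing {2, 3}
  but not 1, which meet \<open>X\<close>: these are \<open>(n-3) choose (r-2)\<close>, strictly more
  by Pascal's rule.\<close>

lemma not_EKR_triangle:
  assumes X: "X \<inter> {2,3} \<noteq> {}" "X - {2,3} = {x}" and r: "3 \<le> r" "r + 1 \<le> n"
  shows "\<not> EKR n r X"
proof
  assume ekr: "EKR n r X"
  have x: "x \<in> {4..n}"
  proof -
    have "x \<in> {2..n}" "x \<noteq> 2" "x \<noteq> 3" using ekr X(2) unfolding EKR_def by blast+
    thus ?thesis by auto
  qed
  define T where "T = {A \<in> nsets {1..n} r. 2 \<le> card (A \<inter> {..3})}"
  have "compressed n r T"
    unfolding compressed_def
  proof (intro ballI impI)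
    fix A B assume AB: "A \<in> T" "B \<in> nsets {1..n} r" "compression_le B A"
    hence "card (A \<inter> {..3}) \<le> card (B \<inter> {..3})"
      by (intro compression_le_card) (auto simp: T_def nsets_def)
    thus "B \<in> T" using AB unfolding T_def by auto
  qed
  moreover have "intersecting T"
    unfolding intersecting_def
  proof (intro ballI notI)
    fix A B assume AB: "A \<in> T" "B \<in> T" "A \<inter> B = {}"
    hence "card (A \<inter> {..3}) + card (B \<inter> {..3}) \<le> 3"
      by (intro card_initial_add_le[of A n]) (auto simp: T_def nsets_def)
    thus False using AB by (auto simp: T_def)
  qed
  moreover have "T \<subseteq> nsets {1..n} r" by (auto simp: T_def)
  ultimately have le: "card (hitting T X) \<le> card (hitting (star n r) X)"
    using ekr unfolding EKR_def by blast
  let ?T = "hitting T X" and ?S = "hitting (star n r) X"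
  have fin: "finite ?T" "finite ?S"
    by (simp_all add: hitting_def T_def star_def finite_imp_finite_nsets)
  let ?P = "{A \<in> nsets {1..n} r. {1,x} \<subseteq> A \<and> A \<inter> {2,3} = {}}"
  let ?Q = "{A \<in> nsets {1..n} r. {2,3} \<subseteq> A \<and> A \<inter> {1} = {}}"
  have "?S - ?T \<subseteq> ?P"
  proof
    fix A assume A: "A \<in> ?S - ?T"
    hence A1: "1 \<in> A" "\<not> 2 \<le> card (A \<inter> {..3})" by (auto simp: hitting_def star_def T_def)
    have "a \<notin> A" if "a = 2 \<or> a = 3" for a
    proof
      assume "a \<in> A"
      hence "card {1,a} \<le> card (A \<inter> {..3})" using that A1 by (intro card_mono) auto
      thus False using that A1 by auto
    qed
    hence "2 \<notin> A" "3 \<notin> A" by blast+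
    moreover obtain a where "a \<in> A" "a \<in> X" using A by (auto simp: hitting_def)
    ultimately have "x \<in> A" using X(2) by (metis DiffI insertE singletonD)
    thus "A \<in> ?P" using A A1 \<open>2 \<notin> A\<close> \<open>3 \<notin> A\<close> by (simp add: hitting_def star_def)
  qed
  hence "card (?S - ?T) \<le> card ?P" by (intro card_mono) (auto simp: finite_imp_finite_nsets)
  also have "card ?P = (n-4) choose (r-2)"
  proof -
    have "card {1,x} = 2" using x by simp
    moreover have "card ?P = (card {1..n} - card {1,x} - card {2,3::nat}) choose (r - card {1,x})"
      using x r \<open>card {1,x} = 2\<close> by (intro card_nsets_between) auto
    ultimately show ?thesis by simp
  qed
  also have "\<dots> < (n-3) choose (r-2)"
  proof -
    have "(n-3) choose (r-2) = ((n-4) choose (r-3)) + ((n-4) choose (r-2))"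
      using choose_reduce_nat[of "n-3" "r-2"] r by simp
    moreover have "0 < (n-4) choose (r-3)" using r by (intro zero_less_binomial) auto
    ultimately show ?thesis by simp
  qed
  also have "\<dots> = card ?Q"
  proof -
    have "card ?Q = (card {1..n} - card {2,3::nat} - card {1::nat}) choose (r - card {2,3::nat})"
      using r by (intro card_nsets_between) auto
    also have "\<dots> = (n-3) choose (r-2)" by (simp add: numeral_3_eq_3 numeral_2_eq_2)
    finally show ?thesis by (rule sym)
  qed
  also have "\<dots> \<le> card (?T - ?S)"
  proof (rule card_mono)
    show "?Q \<subseteq> ?T - ?S"
    proof
      fix A assume A: "A \<in> ?Q"
      hence "card {2,3::nat} \<le> card (A \<inter> {..3})" by (intro card_mono) auto
      thus "A \<in> ?T - ?S" using A X(1) by (auto simp: hitting_def star_def T_def)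
    qed
  qed (use fin in simp)
  finally have "card (?S - ?T) < card (?T - ?S)" .
  moreover have "card ?S = card (?S \<inter> ?T) + card (?S - ?T)" "card ?T = card (?S \<inter> ?T) + card (?T - ?S)"
    using card_Int_Diff[OF fin(2), of ?T] card_Int_Diff[OF fin(1), of ?S] by (simp_all add: Int_commute)
  ultimately show False using le by linarith
qed

lemma eventually_EKR_cases:
  assumes "eventually_EKR r X" "3 \<le> r" "X \<noteq> {}"
  shows "\<not> X \<subseteq> {2..r+1}" "X \<inter> {2,3} = {} \<or> 2 \<le> card (X - {2,3})"
proof -
  obtain N where N: "\<And>n. n \<ge> N \<Longrightarrow> EKR n r X"
    using assms unfolding eventually_EKR_def eventually_sequentially by blast
  \<comment> \<open>Both counterexample families live on [n] with n \<ge> r + 1, hence the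
    maximum.\<close>
  have ekr: "EKR (max N (r+1)) r X" using N by simp
  show init: "\<not> X \<subseteq> {2..r+1}"
    using not_EKR_initial[of X r "max N (r+1)"] ekr assms by auto
  show "X \<inter> {2,3} = {} \<or> 2 \<le> card (X - {2,3})"
  proof (rule ccontr)
    assume neg: "\<not> ?thesis"
    have "X - {2,3} \<noteq> {}"
    proof
      assume "X - {2,3} = {}"
      hence "X \<subseteq> {2,3}" by blast
      also have "\<dots> \<subseteq> {2..r+1}" using assms(2) by auto
      finally show False using init by simp
    qed
    moreover have "finite (X - {2,3})" using assms(1) by (simp add: eventually_EKR_def)
    ultimately have "card (X - {2,3}) \<noteq> 0" by simp
    with neg have "card (X - {2,3}) = 1" by linarith
    then obtain x where "X - {2,3} = {x}" by (auto simp: card_1_singleton_iff)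
    with not_EKR_triangle[of X x r "max N (r+1)"] neg ekr assms(2) show False by simp
  qed
qed

section \<open>Thresholds for n\<close>

text \<open>If |X| \<le> 2, meeting {2, 3} would leave at most one element outside it, so
  \<open>X\<close> misses {2, 3} and r + 4 + |X| \<le> 2r suffices. If |X| \<ge> 3, two elements lie
  outside {2, 3} in either case, and the factor 2r + 3 enters.\<close>

lemma EKR_of_eventually_EKR:
  assumes ev: "eventually_EKR r X" "X \<subseteq> {2..n}" and r: "11 \<le> r" "2 * r\<^sup>2 \<le> n"
    and large: "3 \<le> card X \<Longrightarrow> (2 * r + 3) * r \<le> n"
  shows "EKR n r X"
proof (cases "X = {}")
  case True
  thus ?thesis by (auto simp: EKR_def hitting_def)
next
  case False
  have "11 * r \<le> r * r" using r by (intro mult_right_mono) auto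
  hence n: "20 * r \<le> n" using r(2) unfolding power2_eq_square by linarith
  have finX: "finite X" using ev(1) by (simp add: eventually_EKR_def)
  note cases = eventually_EKR_cases[OF ev(1) _ False]
  show ?thesis
  proof (cases "card X \<le> 2")
    case True
    have "X \<inter> {2,3} = {}"
    proof (rule ccontr)
      assume ne: "X \<inter> {2,3} \<noteq> {}"
      hence "X - {2,3} \<subset> X" by blast
      hence "card (X - {2,3}) < card X" using finX by (intro psubset_card_mono)
      thus False using cases(2) r True ne by simp
    qed
    moreover have "(r + 4 + card X) * r \<le> (2 * r) * r" using True r by (intro mult_right_mono) auto
    hence "(r + 4 + card X) * r \<le> n"
      using r(2) unfolding power2_eq_square mult.assoc by (rule order.trans)
    ultimately show ?thesis using ev cases(1) r n by (intro EKR_avoiding_23) auto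
  next
    case False
    have "2 \<le> card (X - {2,3})"
    proof (cases "X \<inter> {2,3} = {}")
      case True
      hence "X - {2,3} = X" by blast
      thus ?thesis using \<open>\<not> card X \<le> 2\<close> by simp
    next
      case False
      have "3 \<le> r" using r by simp
      from cases(2)[OF this] False show ?thesis by blast
    qed
    thus ?thesis using ev cases(1) r n large False by (intro EKR_two_outside_23) auto
  qed
qed

theorem theorem4:
  shows "(\<forall>\<epsilon>::real. \<epsilon> > 0 \<longrightarrow>
            (\<exists>r0::nat. \<forall>r>r0. r \<ge> 3 \<longrightarrow>
               (\<forall>(X::nat set) (n::nat).
                  finite X \<and> X \<subseteq> {2..} \<and> card X \<le> r \<and> eventually_EKR r X \<and>
                  real n > (2 + \<epsilon>) * (real r)^2 \<and> X \<subseteq> {2..n} \<longrightarrow> EKR n r X)))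
       \<and> (\<forall>(r::nat) (X::nat set) (n::nat).
            r \<ge> 3 \<and> finite X \<and> X \<subseteq> {2..} \<and> card X \<le> r \<and> eventually_EKR r X \<and> X \<subseteq> {2..n} \<longrightarrow>
              (card X = 1 \<and> r \<ge> 12 \<longrightarrow> n > 2 * r^2 \<longrightarrow> EKR n r X)
            \<and> (card X = 2 \<and> r \<ge> 14 \<longrightarrow> n > 2 * r^2 \<longrightarrow> EKR n r X)
            \<and> (card X = 3 \<and> r \<ge> 14 \<longrightarrow> n > 3 * r^2 \<longrightarrow> EKR n r X)
            \<and> (\<forall>t::nat. card X = t \<and> t \<ge> 4 \<and> r \<ge> max 11 t \<longrightarrow> n > t * r^2 \<longrightarrow> EKR n r X))"
proof (intro conjI allI impI)
  fix \<epsilon> :: real assume eps: "\<epsilon> > 0"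
  \<comment> \<open>The 11 comes from \<open>EKR_of_eventually_EKR\<close>; r \<ge> 3/\<epsilon>
    makes the surplus \<epsilon> r r at least 3r, the excess of (2r + 3)r over 2rr.\<close>
  define r0 where "r0 = max 11 (nat \<lceil>3 / \<epsilon>\<rceil>)"
  show "\<exists>r0::nat. \<forall>r>r0. r \<ge> 3 \<longrightarrow> (\<forall>(X::nat set) (n::nat).
      finite X \<and> X \<subseteq> {2..} \<and> card X \<le> r \<and> eventually_EKR r X \<and>
      real n > (2 + \<epsilon>) * (real r)^2 \<and> X \<subseteq> {2..n} \<longrightarrow> EKR n r X)"
  proof (intro exI[of _ r0] allI impI, elim conjE)
    fix r n :: nat and X :: "nat set"
    assume r: "r0 < r" and X: "eventually_EKR r X" "X \<subseteq> {2..n}"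
      and n: "(2 + \<epsilon>) * (real r)^2 < real n"
    have "3 / \<epsilon> \<le> real r" using r unfolding r0_def by linarith
    hence er: "3 \<le> \<epsilon> * real r" using eps by (simp add: field_simps)
    have "real (2 * r\<^sup>2) \<le> (2 + \<epsilon>) * (real r)^2" using eps by (simp add: algebra_simps)
    hence "real (2 * r\<^sup>2) \<le> real n" using n by linarith
    hence n2: "2 * r\<^sup>2 \<le> n" by (simp only: of_nat_le_iff)
    have "real ((2 * r + 3) * r) = (2 * real r + 3) * real r" by simp
    also have "\<dots> \<le> (2 * real r + \<epsilon> * real r) * real r" using er by (intro mult_right_mono) auto
    also have "\<dots> \<le> real n" using n by (simp add: power2_eq_square algebra_simps)
    finally have "(2 * r + 3) * r \<le> n" by (simp only: of_nat_le_iff)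
    thus "EKR n r X" using r X n2 by (intro EKR_of_eventually_EKR) (auto simp: r0_def)
  qed
next
  fix r n :: nat and X :: "nat set"
  assume A: "r \<ge> 3 \<and> finite X \<and> X \<subseteq> {2..} \<and> card X \<le> r \<and> eventually_EKR r X \<and> X \<subseteq> {2..n}"
  have small: "EKR n r X" if "card X \<le> 2" "11 \<le> r" "2 * r^2 < n"
    using A that by (intro EKR_of_eventually_EKR) auto
  have large: "EKR n r X" if "t * r^2 < n" "3 \<le> t" "11 \<le> r" for t
  proof -
    have "3 * r^2 \<le> t * r^2" using that by (intro mult_right_mono) auto
    hence n: "3 * r^2 \<le> n" using that by linarith
    \<comment> \<open>For sets of at least three elements the factor \<open>t \<ge> 3\<close>
      absorbs the 3, since 2r + 3 \<le> 3r.\<close>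
    have "(2 * r + 3) * r \<le> (3 * r) * r" using that by (intro mult_right_mono) auto
    hence "(2 * r + 3) * r \<le> n" using n unfolding power2_eq_square mult.assoc by (rule order.trans)
    thus ?thesis using A that n by (intro EKR_of_eventually_EKR) auto
  qed
  show "card X = 1 \<and> r \<ge> 12 \<Longrightarrow> n > 2 * r^2 \<Longrightarrow> EKR n r X" using small by simp
  show "card X = 2 \<and> r \<ge> 14 \<Longrightarrow> n > 2 * r^2 \<Longrightarrow> EKR n r X" using small by simp
  show "card X = 3 \<and> r \<ge> 14 \<Longrightarrow> n > 3 * r^2 \<Longrightarrow> EKR n r X" using large[of 3] by simp
  show "card X = t \<and> t \<ge> 4 \<and> r \<ge> max 11 t \<Longrightarrow> n > t * r^2 \<Longrightarrow> EKR n r X" for t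
    using large[of t] by simp
qed

end
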